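(* Let $G$ be a real Lie group acting continuously on a locally compact second countable metrizable space $X$, and let $E$ be a set with a coding map $E\to G$, $e\mapsto g_e$. Suppose that $E$ is finite and that a given Markov chain on $E$ is irreducible. If $x\in X$ and $e\in E$ are such that the random orbit $\{g_{\omega|_n}x : n\in\mathbb{N}\}\subset X$ is infinite for $\mathbb{P}_e$-a.e. $\omega\in E^{\mathbb{N}}$, then the orbit $G_e^+x$ is infinite.
   Context: $\mathbb{P}_e$ is the Markov measure on $\Omega=E^{\mathbb{N}}$ (indices from $0$) started at $\omega_0=e$; $\tau_e(\omega)=\inf\{n\ge1:\omega_n=e\}$. Irreducible: $\mathbb{P}_e[\tau_{e'}<\infty]>0$ for all $e,e'$. For $\omega\in\Omega$, $g_{\omega|_n}=g_{\omega_{n-1}}\cdots g_{\omega_0}$. The renewal measure $\mu_e$ is the law on $G$ of $g_{\omega|_{\tau_e}}=g_{\omega_{\tau_e-1}}\cdots g_{\omega_0}$ under $\mathbb{P}_e$, and $G_e^+$ is the closed subsemigroup of $G$ generated by $\operatorname{supp}(\mu_e)$. *)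

theory Defs
  imports "HOL-Probability.Probability" "HOL-Algebra.Group_Action"
begin

section \<open>Real Lie groups\<close>

text \<open>
  Coordinates live in the library's \<^const>\<open>Euclidean_space\<close> \<open>n\<close>, whose points are the
  sequences \<open>nat \<Rightarrow> real\<close> vanishing from index \<open>n\<close> on. This makes every dimension available,
  including dimension 0 (discrete groups).
\<close>

primrec Ck_on :: "nat \<Rightarrow> nat \<Rightarrow> (nat \<Rightarrow> real) set \<Rightarrow> ((nat \<Rightarrow> real) \<Rightarrow> real) \<Rightarrow> bool" where
  "Ck_on n 0 U f \<longleftrightarrow> continuous_map (subtopology (Euclidean_space n) U) euclideanreal f"
| "Ck_on n (Suc k) U f \<longleftrightarrow>
     continuous_map (subtopology (Euclidean_space n) U) euclideanreal f \<and>
     (\<forall>i<n. \<exists>f'. (\<forall>x\<in>U. ((\<lambda>t. f (x(i := t))) has_real_derivative f' x) (at (x i))) \<and>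
                 Ck_on n k U f')"

definition smooth_on ::
    "nat \<Rightarrow> nat \<Rightarrow> (nat \<Rightarrow> real) set \<Rightarrow> ((nat \<Rightarrow> real) \<Rightarrow> (nat \<Rightarrow> real)) \<Rightarrow> bool" where
  "smooth_on n m U f \<longleftrightarrow> (\<forall>j<m. \<forall>k. Ck_on n k U (\<lambda>x. f x j))"

text \<open>A chart is a pair of its domain and its coordinate map.\<close>

type_synonym 'a chart = "'a set \<times> ('a \<Rightarrow> nat \<Rightarrow> real)"

definition smooth_atlas :: "nat \<Rightarrow> 'a topology \<Rightarrow> 'a chart set \<Rightarrow> bool" where
  "smooth_atlas n T A \<longleftrightarrow>
     (\<Union>(U, \<phi>)\<in>A. U) = topspace T \<and>
     (\<forall>(U, \<phi>)\<in>A. openin T U \<and> openin (Euclidean_space n) (\<phi> ` U) \<and>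
        homeomorphic_map (subtopology T U) (subtopology (Euclidean_space n) (\<phi> ` U)) \<phi>) \<and>
     (\<forall>(U, \<phi>)\<in>A. \<forall>(V, \<psi>)\<in>A. smooth_on n n (\<phi> ` (U \<inter> V)) (\<psi> \<circ> inv_into U \<phi>))"

definition smooth_map ::
    "nat \<Rightarrow> 'a topology \<Rightarrow> 'a chart set \<Rightarrow> nat \<Rightarrow> 'b topology \<Rightarrow> 'b chart set \<Rightarrow> ('a \<Rightarrow> 'b) \<Rightarrow> bool" where
  "smooth_map n T A m T' A' f \<longleftrightarrow>
     continuous_map T T' f \<and>
     (\<forall>(U, \<phi>)\<in>A. \<forall>(V, \<psi>)\<in>A'.
        smooth_on n m (\<phi> ` (U \<inter> f -` V)) (\<psi> \<circ> f \<circ> inv_into U \<phi>))"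

text \<open>The product charts identify \<open>\<real>\<^sup>n \<times> \<real>\<^sup>m\<close> with \<open>\<real>\<^sup>n\<^sup>+\<^sup>m\<close> by concatenating coordinates.\<close>

definition prod_atlas :: "nat \<Rightarrow> 'a chart set \<Rightarrow> 'b chart set \<Rightarrow> ('a \<times> 'b) chart set" where
  "prod_atlas n A B =
     {(U \<times> V, \<lambda>(a, b) i. if i < n then \<phi> a i else \<psi> b (i - n)) | U \<phi> V \<psi>.
        (U, \<phi>) \<in> A \<and> (V, \<psi>) \<in> B}"

text \<open>
  Second countability is not imposed, so that Lie groups with uncountably many connected
  components are covered as well; under the convention that manifolds are second countable
  one obtains a special case.
\<close>

definition real_Lie_group ::
    "('g, 'b) monoid_scheme \<Rightarrow> 'g topology \<Rightarrow> nat \<Rightarrow> 'g chart set \<Rightarrow> bool" where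
  "real_Lie_group G T n A \<longleftrightarrow>
     group G \<and> topspace T = carrier G \<and> Hausdorff_space T \<and> smooth_atlas n T A \<and>
     smooth_map (n + n) (prod_topology T T) (prod_atlas n A A) n T A (\<lambda>(a, b). a \<otimes>\<^bsub>G\<^esub> b) \<and>
     smooth_map n T A n T A (\<lambda>a. inv\<^bsub>G\<^esub> a)"

definition continuous_action ::
    "('g, 'b) monoid_scheme \<Rightarrow> 'g topology \<Rightarrow> 'x topology \<Rightarrow> ('g \<Rightarrow> 'x \<Rightarrow> 'x) \<Rightarrow> bool" where
  "continuous_action G T X act \<longleftrightarrow>
     group_action G (topspace X) act \<and>
     continuous_map (prod_topology T X) X (\<lambda>(h, x). act h x)"


section \<open>Markov measures on sequence space\<close>

text \<open>
  \<open>K a\<close> is the distribution of the next state when the current state is \<open>a\<close>. The Markov measure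
  started at \<open>e\<close> is obtained from the Ionescu-Tulcea theorem; the lemma \<open>emeasure_markov_cylinder\<close>
  below gives its values on cylinders.
\<close>

definition markov_kernel :: "('e \<Rightarrow> 'e pmf) \<Rightarrow> 'e \<Rightarrow> nat \<Rightarrow> (nat \<Rightarrow> 'e) \<Rightarrow> 'e measure" where
  "markov_kernel K e i \<omega> = measure_pmf (if i = 0 then return_pmf e else K (\<omega> (i - 1)))"

definition markov_measure :: "('e \<Rightarrow> 'e pmf) \<Rightarrow> 'e \<Rightarrow> (nat \<Rightarrow> 'e) measure" where
  "markov_measure K e =
     projective_family.lim UNIV
       (Ionescu_Tulcea.CI (markov_kernel K e) (\<lambda>_. count_space UNIV)) (\<lambda>_. count_space UNIV)"

lemma Ionescu_Tulcea_markov_kernel: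
  "Ionescu_Tulcea (markov_kernel K e) (\<lambda>_. count_space UNIV)"
proof (rule Ionescu_Tulcea.intro)
  fix i :: nat
  show "markov_kernel K e i \<in>
      measurable (PiM {0..<i} (\<lambda>_. count_space UNIV)) (subprob_algebra (count_space UNIV))"
  proof (cases "i = 0")
    case True
    then show ?thesis
      by (simp add: markov_kernel_def[abs_def] measure_pmf_in_subprob_algebra)
  next
    case False
    then have "(\<lambda>\<omega>. \<omega> (i - 1)) \<in>
        measurable (PiM {0..<i} (\<lambda>_. count_space UNIV)) (count_space (UNIV :: 'a set))"
      by (intro measurable_component_singleton) auto
    moreover have "(\<lambda>a. measure_pmf (K a)) \<in>
        measurable (count_space UNIV) (subprob_algebra (count_space UNIV))"
      by (simp add: measure_pmf_in_subprob_algebra)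
    ultimately show ?thesis
      using False by (simp add: markov_kernel_def[abs_def] measurable_compose)
  qed
next
  fix i and \<omega> :: "nat \<Rightarrow> 'a"
  show "prob_space (markov_kernel K e i \<omega>)"
    by (simp add: markov_kernel_def measure_pmf.prob_space_axioms)
qed

lemma sets_markov_measure:
  "sets (markov_measure K e) = sets (PiM UNIV (\<lambda>_. count_space UNIV))"
proof -
  interpret Ionescu_Tulcea "markov_kernel K e" "\<lambda>_. count_space UNIV"
    by (rule Ionescu_Tulcea_markov_kernel)
  show ?thesis by (simp add: markov_measure_def)
qed

lemma emeasure_markov_cylinder:
  "emeasure (markov_measure K e) {\<omega>. \<forall>i\<le>n. \<omega> i = a i} =
     (if a 0 = e then ennreal (\<Prod>i<n. pmf (K (a i)) (a (Suc i))) else 0)"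
proof -
  interpret Ionescu_Tulcea "markov_kernel K e" "\<lambda>_. count_space UNIV"
    by (rule Ionescu_Tulcea_markov_kernel)
  let ?M = "\<lambda>_::nat. count_space (UNIV :: 'a set)"
  define A where "A n = PiE {0..<n} (\<lambda>i. {a i})" for n :: nat
  define u :: "nat \<Rightarrow> 'a" where "u = (\<lambda>_. undefined)"
  have A_sets[measurable]: "A n \<in> sets (PiM {0..<n} ?M)" for n
    unfolding A_def by (rule sets_PiM_I_finite) auto
  have u[simp]: "u \<in> space (PiM {0..<0} ?M)"
    by (simp add: u_def space_PiM)
  have Csets: "sets (C 0 m u) = sets (PiM {0..<m} ?M)" for m
    using sets_C[OF u, of m] by simp
  have Cspace: "space (C 0 m u) = space (PiM {0..<m} ?M)" for m
    using space_C[OF u, of m] by simp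
  have step: "emeasure (C 0 (Suc m) u) (A (Suc m)) =
      emeasure (markov_kernel K e m a) {a m} * emeasure (C 0 m u) (A m)" for m
  proof -
    have "emeasure (C 0 (Suc m) u) (A (Suc m)) = (\<integral>\<^sup>+\<omega>. emeasure (eP m \<omega>) (A (Suc m)) \<partial>C 0 m u)"
      using measurable_eP[of m]
      by (simp, intro emeasure_bind[where N = "PiM {0..<Suc m} ?M"])
         (auto simp: Cspace measurable_cong_sets[OF Csets refl] A_sets space_PiM PiE_eq_empty_iff)
    also have "\<dots> = (\<integral>\<^sup>+\<omega>. emeasure (markov_kernel K e m a) {a m} * indicator (A m) \<omega> \<partial>C 0 m u)"
    proof (rule nn_integral_cong)
      fix \<omega> assume "\<omega> \<in> space (C 0 m u)"
      then have \<omega>: "\<omega> \<in> space (PiM {0..<m} ?M)" by (simp add: Cspace)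
      have 1: "emeasure (eP m \<omega>) (A (Suc m)) =
          emeasure (markov_kernel K e m \<omega>) ((\<lambda>x. fun_upd \<omega> m x) -` A (Suc m) \<inter> UNIV)"
        using emeasure_eP[OF \<omega> A_sets] by simp
      show "emeasure (eP m \<omega>) (A (Suc m)) =
          emeasure (markov_kernel K e m a) {a m} * indicator (A m) \<omega>"
      proof (cases "\<omega> \<in> A m")
        case True
        then have "(\<lambda>x. fun_upd \<omega> m x) -` A (Suc m) \<inter> UNIV = {a m}"
          by (auto simp: A_def PiE_iff extensional_def split: if_splits)
        moreover have "markov_kernel K e m \<omega> = markov_kernel K e m a"
          using True by (cases m) (auto simp: A_def markov_kernel_def PiE_iff)
        ultimately show ?thesis using True 1 by simp
      next
        case False
        have "\<omega> \<in> extensional {0..<m}" using \<omega> by (simp add: space_PiM PiE_iff)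
        with False obtain i where "i < m" "\<omega> i \<noteq> a i"
          by (auto simp: A_def PiE_iff)
        then have "(\<lambda>x. fun_upd \<omega> m x) -` A (Suc m) \<inter> UNIV = {}"
          by (auto simp: A_def PiE_iff dest!: bspec[where x = i])
        then show ?thesis using False 1 by simp
      qed
    qed
    also have "\<dots> = emeasure (markov_kernel K e m a) {a m} * emeasure (C 0 m u) (A m)"
      by (subst nn_integral_cmult_indicator) (auto simp: Csets A_sets)
    finally show ?thesis .
  qed
  have C0: "emeasure (C 0 0 u) (A 0) = 1"
    using A_sets[of 0] by (simp add: A_def u_def)
  have main: "emeasure (C 0 (Suc m) u) (A (Suc m)) =
      (if a 0 = e then ennreal (\<Prod>i<m. pmf (K (a i)) (a (Suc i))) else 0)" for m
  proof (induction m)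
    case 0
    then show ?case
      unfolding step C0 by (auto simp: markov_kernel_def emeasure_pmf_single)
  next
    case (Suc m)
    have "emeasure (markov_kernel K e (Suc m) a) {a (Suc m)} = ennreal (pmf (K (a m)) (a (Suc m)))"
      by (simp add: markov_kernel_def emeasure_pmf_single)
    then show ?case
      unfolding step[of "Suc m"] Suc.IH
      by (simp add: ennreal_mult[symmetric] prod_nonneg mult.commute)
  qed
  have "{\<omega>. \<forall>i\<le>n. \<omega> i = a i} = PF.emb UNIV {0..<Suc n} (A (Suc n))"
    by (auto simp: prod_emb_def A_def PiE_iff space_PiM less_Suc_eq_le)
  then have "emeasure (markov_measure K e) {\<omega>. \<forall>i\<le>n. \<omega> i = a i} =
      emeasure (CI {0..<Suc n}) (A (Suc n))"
    using lim[of "{0..<Suc n}" "A (Suc n)"] A_sets by (simp add: markov_measure_def)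
  also have "\<dots> = emeasure (C 0 (Suc n) u) (PF.emb {0..<Suc n} {0..<Suc n} (A (Suc n)))"
    unfolding u_def by (rule emeasure_CI) (auto intro: A_sets)
  also have "PF.emb {0..<Suc n} {0..<Suc n} (A (Suc n)) = A (Suc n)"
    by (auto simp: prod_emb_def A_def PiE_iff extensional_restrict)
  finally show ?thesis using main by simp
qed

text \<open>The first return (or hitting) time ignores time 0.\<close>

definition hitting_time :: "'e \<Rightarrow> (nat \<Rightarrow> 'e) \<Rightarrow> enat" where
  "hitting_time e \<omega> = Inf {enat n | n. n \<ge> 1 \<and> \<omega> n = e}"

definition irreducible_chain :: "('e \<Rightarrow> 'e pmf) \<Rightarrow> bool" where
  "irreducible_chain K \<longleftrightarrow>
     (\<forall>e e'. emeasure (markov_measure K e)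
        {\<omega> \<in> space (markov_measure K e). hitting_time e' \<omega> < \<infinity>} > 0)"


section \<open>Random products, renewal measure and renewal semigroup\<close>

text \<open>\<open>word_prod G g \<omega> n\<close> is \<open>g\<^bsub>\<omega>(n-1)\<^esub> \<cdots> g\<^bsub>\<omega>(0)\<^esub>\<close>: later factors multiply on the left.\<close>

primrec word_prod :: "('g, 'b) monoid_scheme \<Rightarrow> ('e \<Rightarrow> 'g) \<Rightarrow> (nat \<Rightarrow> 'e) \<Rightarrow> nat \<Rightarrow> 'g" where
  "word_prod G g \<omega> 0 = \<one>\<^bsub>G\<^esub>"
| "word_prod G g \<omega> (Suc n) = g (\<omega> n) \<otimes>\<^bsub>G\<^esub> word_prod G g \<omega> n"

definition borel_of :: "'a topology \<Rightarrow> 'a measure" where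
  "borel_of T = sigma (topspace T) {U. openin T U}"

definition msupport :: "'a topology \<Rightarrow> 'a measure \<Rightarrow> 'a set" where
  "msupport T \<mu> = {x \<in> topspace T. \<forall>U. openin T U \<and> x \<in> U \<longrightarrow> emeasure \<mu> U > 0}"

text \<open>
  For an irreducible chain on a finite state space the return time is almost surely finite, so
  the junk value \<open>the_enat \<infinity>\<close> does not affect the law.
\<close>

definition renewal_measure ::
    "('g, 'b) monoid_scheme \<Rightarrow> 'g topology \<Rightarrow> ('e \<Rightarrow> 'g) \<Rightarrow> ('e \<Rightarrow> 'e pmf) \<Rightarrow> 'e \<Rightarrow> 'g measure" where
  "renewal_measure G T g K e =
     distr (markov_measure K e) (borel_of T) (\<lambda>\<omega>. word_prod G g \<omega> (the_enat (hitting_time e \<omega>)))"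

definition closed_subsemigroup ::
    "('g, 'b) monoid_scheme \<Rightarrow> 'g topology \<Rightarrow> 'g set \<Rightarrow> bool" where
  "closed_subsemigroup G T S \<longleftrightarrow>
     closedin T S \<and> S \<subseteq> carrier G \<and> (\<forall>a\<in>S. \<forall>b\<in>S. a \<otimes>\<^bsub>G\<^esub> b \<in> S)"

definition renewal_semigroup ::
    "('g, 'b) monoid_scheme \<Rightarrow> 'g topology \<Rightarrow> ('e \<Rightarrow> 'g) \<Rightarrow> ('e \<Rightarrow> 'e pmf) \<Rightarrow> 'e \<Rightarrow> 'g set" where
  "renewal_semigroup G T g K e =
     \<Inter>{S. closed_subsemigroup G T S \<and> msupport T (renewal_measure G T g K e) \<subseteq> S}"

end

theory Submission
  imports Defs
begin

text \<open>
  Almost every trajectory only uses transitions of positive probability. By irreducibility, for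
  each of the finitely many states \<open>a\<close> one can fix such a path from \<open>a\<close> back to \<open>e\<close>, with product
  \<open>h a\<close>. Closing up a trajectory with \<open>\<omega> 0 = e\<close> at time \<open>n\<close> by the path of \<open>\<omega> n\<close> yields a loop at
  \<open>e\<close>, which splits into first-return loops of positive probability; hence
  \<open>h (\<omega> n) \<cdot> g\<^bsub>\<omega>(n-1)\<^esub> \<cdots> g\<^bsub>\<omega>(0)\<^esub>\<close> lies in the renewal semigroup. So the random orbit stays in
  the union over \<open>a\<close> of the translates by \<open>(h a)\<^sup>-\<^sup>1\<close> of the orbit of the renewal semigroup, and
  would be finite if the latter orbit were.
\<close>

lemma hitting_time_eqI:
  assumes "1 \<le> k" "\<omega> k = e" "\<And>i. 1 \<le> i \<Longrightarrow> i < k \<Longrightarrow> \<omega> i \<noteq> e"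
  shows "hitting_time e \<omega> = enat k"
  unfolding hitting_time_def
proof (rule antisym)
  show "Inf {enat n | n. n \<ge> 1 \<and> \<omega> n = e} \<le> enat k"
    using assms(1,2) by (intro Inf_lower) auto
  show "enat k \<le> Inf {enat n | n. n \<ge> 1 \<and> \<omega> n = e}"
  proof (rule Inf_greatest)
    fix N assume "N \<in> {enat n | n. n \<ge> 1 \<and> \<omega> n = e}"
    then obtain n where "N = enat n" "1 \<le> n" "\<omega> n = e"
      by blast
    then show "enat k \<le> N"
      using assms(3)[of n] by (cases "n < k") auto
  qed
qed

lemma hitting_time_finite_iff: "hitting_time e \<omega> < \<infinity> \<longleftrightarrow> (\<exists>n\<ge>1. \<omega> n = e)"
  unfolding hitting_time_def Inf_less_iff by auto

lemma hitting_time_eq_Least: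
  "hitting_time e \<omega> =
     (if \<exists>n. n \<ge> 1 \<and> \<omega> n = e then enat (LEAST n. n \<ge> 1 \<and> \<omega> n = e) else \<infinity>)"
proof (cases "\<exists>n. n \<ge> 1 \<and> \<omega> n = e")
  case True
  then have "(LEAST n. n \<ge> 1 \<and> \<omega> n = e) \<ge> 1 \<and> \<omega> (LEAST n. n \<ge> 1 \<and> \<omega> n = e) = e"
    by (rule LeastI_ex)
  moreover have "\<omega> i \<noteq> e" if "1 \<le> i" "i < (LEAST n. n \<ge> 1 \<and> \<omega> n = e)" for i
    using not_less_Least[OF that(2)] that(1) by auto
  ultimately have "hitting_time e \<omega> = enat (LEAST n. n \<ge> 1 \<and> \<omega> n = e)"
    by (intro hitting_time_eqI) auto
  with True show ?thesis by simp
next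
  case False
  then show ?thesis
    using hitting_time_finite_iff[of e \<omega>] by auto
qed

lemma measurable_markov_component[measurable]:
  "(\<lambda>\<omega>. \<omega> n) \<in> measurable (markov_measure K e) (count_space UNIV)"
  by (subst measurable_cong_sets[OF sets_markov_measure refl]) simp

lemma space_markov_measure[simp]: "space (markov_measure K e) = UNIV"
  using sets_eq_imp_space_eq[OF sets_markov_measure[of K e]] by (simp add: space_PiM)

lemma measurable_hitting_time[measurable]:
  "hitting_time e \<in> measurable (markov_measure K e') (count_space UNIV)"
proof -
  have "Measurable.pred (markov_measure K e') (\<lambda>\<omega>. n \<ge> 1 \<and> \<omega> n = e)" for n
    by measurable
  then have [measurable]: "{\<omega>. n \<ge> 1 \<and> \<omega> n = e} \<in> sets (markov_measure K e')" for n
    by (simp add: pred_def)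
  have "(\<lambda>\<omega>. if \<exists>n. n \<ge> 1 \<and> \<omega> n = e then enat (LEAST n. n \<ge> 1 \<and> \<omega> n = e) else \<infinity>)
      \<in> measurable (markov_measure K e') (count_space UNIV)"
    by (intro measurable_If measurable_compose[OF measurable_Least, where g = enat]
        pred_intros_countable(2)[unfolded pred_def]) (auto simp del: One_nat_def)
  then show ?thesis
    by (simp only: hitting_time_eq_Least[abs_def])
qed

lemma sets_markov_cylinder[measurable]:
  "{\<omega>. \<forall>i\<le>n. \<omega> i = a i} \<in> sets (markov_measure K e)"
proof -
  have "{\<omega> \<in> space (markov_measure K e). \<forall>i\<le>n. \<omega> i = a i} \<in> sets (markov_measure K e)"
    by measurable
  then show ?thesis by simp
qed

definition admissible :: "('e \<Rightarrow> 'e pmf) \<Rightarrow> (nat \<Rightarrow> 'e) \<Rightarrow> nat \<Rightarrow> bool" where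
  "admissible K f n \<longleftrightarrow> (\<forall>i<n. f (Suc i) \<in> set_pmf (K (f i)))"

lemma emeasure_markov_cylinder_eq_0_iff:
  "emeasure (markov_measure K e) {\<omega>. \<forall>i\<le>n. \<omega> i = a i} = 0 \<longleftrightarrow>
     \<not> (a 0 = e \<and> admissible K a n)"
proof -
  have "(\<Prod>i<n. pmf (K (a i)) (a (Suc i))) > 0 \<longleftrightarrow> admissible K a n"
  proof
    assume "admissible K a n"
    then show "(\<Prod>i<n. pmf (K (a i)) (a (Suc i))) > 0"
      by (intro prod_pos) (auto simp: admissible_def pmf_positive)
  next
    assume "(\<Prod>i<n. pmf (K (a i)) (a (Suc i))) > 0"
    then have "\<forall>i<n. pmf (K (a i)) (a (Suc i)) \<noteq> 0"
      by (metis finite_lessThan lessThan_iff less_irrefl prod_zero_iff)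
    then show "admissible K a n"
      by (auto simp: admissible_def set_pmf_iff)
  qed
  then show ?thesis
    by (auto simp: emeasure_markov_cylinder ennreal_eq_0_iff not_less)
qed

lemma AE_markov_admissible:
  fixes K :: "'e::countable \<Rightarrow> 'e pmf"
  shows "AE \<omega> in markov_measure K e. \<omega> 0 = e \<and> (\<forall>n. admissible K \<omega> n)"
proof -
  have "AE \<omega> in markov_measure K e. \<omega> 0 = e \<and> admissible K \<omega> n" for n
  proof -
    let ?F = "{f \<in> PiE {..n} (\<lambda>_. UNIV). \<not> (f 0 = e \<and> admissible K f n)}"
    let ?N = "\<Union>f\<in>?F. {\<omega>. \<forall>i\<le>n. \<omega> i = f i}"
    have "countable ?F"
      by (rule countable_subset[of _ "PiE {..n} (\<lambda>_. UNIV)"]) (auto intro: countable_PiE)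
    then have "?N \<in> null_sets (markov_measure K e)"
      by (intro null_sets_UN')
        (auto simp: null_sets_def emeasure_markov_cylinder_eq_0_iff simp del: de_Morgan_conj)
    moreover have "{\<omega> \<in> space (markov_measure K e). \<not> (\<omega> 0 = e \<and> admissible K \<omega> n)} \<subseteq> ?N"
    proof
      fix \<omega> assume "\<omega> \<in> {\<omega> \<in> space (markov_measure K e). \<not> (\<omega> 0 = e \<and> admissible K \<omega> n)}"
      then have "restrict \<omega> {..n} \<in> ?F" by (auto simp: admissible_def)
      then show "\<omega> \<in> ?N" by (rule UN_I) simp
    qed
    ultimately show ?thesis by (rule AE_I')
  qed
  then show ?thesis by (simp add: AE_all_countable)
qed

lemma irreducible_chain_path:
  fixes K :: "'e::countable \<Rightarrow> 'e pmf"
  assumes "irreducible_chain K"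
  obtains f m where "f 0 = a" "f m = b" "m \<ge> 1" "admissible K f m"
proof -
  let ?M = "markov_measure K a"
  have pos: "emeasure ?M {\<omega> \<in> space ?M. hitting_time b \<omega> < \<infinity>} \<noteq> 0"
    using assms by (simp only: irreducible_chain_def zero_less_iff_neq_zero not_False_eq_True)
  have "\<exists>\<omega>. hitting_time b \<omega> < \<infinity> \<and> \<omega> 0 = a \<and> (\<forall>n. admissible K \<omega> n)"
  proof (rule ccontr)
    assume none: "\<nexists>\<omega>. hitting_time b \<omega> < \<infinity> \<and> \<omega> 0 = a \<and> (\<forall>n. admissible K \<omega> n)"
    have "AE \<omega> in ?M. \<not> hitting_time b \<omega> < \<infinity>"
      using AE_markov_admissible[where K = K and e = a] by eventually_elim (use none in blast)
    moreover have "{\<omega> \<in> space ?M. hitting_time b \<omega> < \<infinity>} \<in> sets ?M"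
      by measurable
    ultimately show False
      using pos by (subst (asm) AE_iff_measurable) auto
  qed
  then show thesis
    using that unfolding hitting_time_finite_iff by blast
qed

lemma word_prod_cong:
  "(\<And>i. i < n \<Longrightarrow> f i = f' i) \<Longrightarrow> word_prod G g f n = word_prod G g f' n"
  by (induction n) auto

context group
begin

lemma word_prod_closed:
  "(\<And>a. g a \<in> carrier G) \<Longrightarrow> word_prod G g f n \<in> carrier G"
  by (induction n) auto

lemma word_prod_add:
  assumes "\<And>a. g a \<in> carrier G"
  shows "word_prod G g f (n + m) = word_prod G g (\<lambda>i. f (n + i)) m \<otimes> word_prod G g f n"
  using assms by (induction m) (auto simp: word_prod_closed m_assoc)

lemma measurable_word_prod:
  fixes K :: "'e::countable \<Rightarrow> 'e pmf"
  assumes "\<And>a. g a \<in> carrier G"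
  shows "(\<lambda>\<omega>. word_prod G g \<omega> n) \<in> measurable (markov_measure K e) (count_space (carrier G))"
proof (induction n)
  case (Suc n)
  have "(\<lambda>\<omega>. g a \<otimes> word_prod G g \<omega> n)
      \<in> measurable (markov_measure K e) (count_space (carrier G))" for a
    by (rule measurable_compose[OF Suc]) (use assms in auto)
  then show ?case
    unfolding word_prod.simps
    by (rule measurable_compose_countable[where f = "\<lambda>a \<omega>. g a \<otimes> word_prod G g \<omega> n"]) measurable
qed simp

lemma first_return_loop_in_msupport:
  fixes K :: "'e::countable \<Rightarrow> 'e pmf"
  assumes T: "topspace T = carrier G" and g: "\<And>a. g a \<in> carrier G"
    and f: "f 0 = e" "f k = e" "k \<ge> 1" "\<And>i. 1 \<le> i \<Longrightarrow> i < k \<Longrightarrow> f i \<noteq> e" "admissible K f k"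
  shows "word_prod G g f k \<in> msupport T (renewal_measure G T g K e)"
proof -
  let ?M = "markov_measure K e" and ?w = "\<lambda>\<omega>. word_prod G g \<omega> (the_enat (hitting_time e \<omega>))"
  have [simp]: "space (borel_of T) = carrier G" and sets: "\<And>U. openin T U \<Longrightarrow> U \<in> sets (borel_of T)"
    using T openin_subset[of T] by (auto simp: borel_of_def space_measure_of_conv)
  have "?w \<in> measurable ?M (count_space (carrier G))"
    by (rule measurable_compose_countable[OF measurable_word_prod[OF g]]) measurable
  then have w: "?w \<in> measurable ?M (borel_of T)"
    by (rule measurable_compose) auto
  have "emeasure (renewal_measure G T g K e) U > 0"
    if U: "openin T U" "word_prod G g f k \<in> U" for U
  proof -
    let ?C = "{\<omega>. \<forall>i\<le>k. \<omega> i = f i}"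
    have "?C \<subseteq> ?w -` U \<inter> space ?M"
    proof
      fix \<omega> assume \<omega>: "\<omega> \<in> ?C"
      then have "hitting_time e \<omega> = enat k"
        using f by (intro hitting_time_eqI) auto
      moreover have "word_prod G g \<omega> k = word_prod G g f k"
        using \<omega> by (intro word_prod_cong) auto
      ultimately show "\<omega> \<in> ?w -` U \<inter> space ?M"
        using U by simp
    qed
    then have "emeasure ?M ?C \<le> emeasure (renewal_measure G T g K e) U"
      using measurable_sets[OF w sets[OF U(1)]]
      by (simp add: renewal_measure_def emeasure_distr[OF w sets[OF U(1)]] emeasure_mono)
    moreover have "emeasure ?M ?C > 0"
      using f emeasure_markov_cylinder_eq_0_iff[of K e k f] by (simp add: zero_less_iff_neq_zero)
    ultimately show ?thesis by order
  qed
  then show ?thesis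
    using T g by (simp add: msupport_def word_prod_closed)
qed

lemma loop_in_closed_subsemigroup:
  fixes K :: "'e::countable \<Rightarrow> 'e pmf"
  assumes T: "topspace T = carrier G" and g: "\<And>a. g a \<in> carrier G"
    and S: "closed_subsemigroup G T S" "msupport T (renewal_measure G T g K e) \<subseteq> S"
    and f: "f 0 = e" "f m = e" "m \<ge> 1" "admissible K f m"
  shows "word_prod G g f m \<in> S"
  using f
proof (induction m arbitrary: f rule: less_induct)
  case (less m)
  define k where "k = (LEAST n. n \<ge> 1 \<and> f n = e)"
  have k: "k \<ge> 1" "f k = e" "k \<le> m"
    using LeastI[of "\<lambda>n. n \<ge> 1 \<and> f n = e" m] Least_le[of "\<lambda>n. n \<ge> 1 \<and> f n = e" m] less.prems
    by (auto simp: k_def)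
  have "f i \<noteq> e" if "1 \<le> i" "i < k" for i
    using not_less_Least[of i "\<lambda>n. n \<ge> 1 \<and> f n = e"] that by (auto simp: k_def)
  then have first: "word_prod G g f k \<in> S"
    using k less.prems
    by (intro subsetD[OF S(2)] first_return_loop_in_msupport T g) (auto simp: admissible_def)
  show ?case
  proof (cases "k = m")
    case True
    then show ?thesis using first by simp
  next
    case False
    then have "word_prod G g (\<lambda>i. f (k + i)) (m - k) \<in> S"
      using k less.prems by (intro less.IH) (auto simp: admissible_def)
    then show ?thesis
      using first S(1) k word_prod_add[of g f k "m - k", OF g]
      by (simp add: closed_subsemigroup_def)
  qed
qed

lemma loop_in_renewal_semigroup:
  fixes K :: "'e::countable \<Rightarrow> 'e pmf"
  assumes "topspace T = carrier G" "\<And>a. g a \<in> carrier G"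
    and "f 0 = e" "f m = e" "m \<ge> 1" "admissible K f m"
  shows "word_prod G g f m \<in> renewal_semigroup G T g K e"
  unfolding renewal_semigroup_def
proof (rule InterI, clarify)
  fix S assume "closed_subsemigroup G T S" "msupport T (renewal_measure G T g K e) \<subseteq> S"
  then show "word_prod G g f m \<in> S"
    by (rule loop_in_closed_subsemigroup[OF assms(1,2) _ _ assms(3-6)])
qed

lemma closed_up_path_in_renewal_semigroup:
  fixes K :: "'e::countable \<Rightarrow> 'e pmf"
  assumes T: "topspace T = carrier G" and g: "\<And>a. g a \<in> carrier G"
    and \<omega>: "\<omega> 0 = e" "admissible K \<omega> n"
    and v: "v 0 = \<omega> n" "v m = e" "m \<ge> 1" "admissible K v m"
  shows "word_prod G g v m \<otimes> word_prod G g \<omega> n \<in> renewal_semigroup G T g K e"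
proof -
  define f where "f i = (if i < n then \<omega> i else v (i - n))" for i
  have "f (Suc i) \<in> set_pmf (K (f i))" if "i < n + m" for i
  proof -
    consider "Suc i < n" | "Suc i = n" | "n \<le> i" by linarith
    then show ?thesis
    proof cases
      case 3
      then have "i - n < m" "Suc i - n = Suc (i - n)" using that by auto
      with 3 show ?thesis using v by (simp add: f_def admissible_def)
    qed (use \<omega> v in \<open>auto simp: f_def admissible_def\<close>)
  qed
  then have "word_prod G g f (n + m) \<in> renewal_semigroup G T g K e"
    using \<omega> v by (intro loop_in_renewal_semigroup[OF T g]) (auto simp: f_def admissible_def)
  moreover have "word_prod G g f n = word_prod G g \<omega> n"
    by (intro word_prod_cong) (simp add: f_def)
  moreover have "word_prod G g (\<lambda>i. f (n + i)) m = word_prod G g v m"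
    by (simp add: f_def)
  ultimately show ?thesis
    using word_prod_add[of g f n m, OF g] by simp
qed

end

theorem lemma3p18:
  fixes G :: "('g, 'b) monoid_scheme" and T :: "'g topology" and d :: nat
    and A :: "'g chart set"
    and X :: "'x topology" and act :: "'g \<Rightarrow> 'x \<Rightarrow> 'x"
    and g :: "'e::finite \<Rightarrow> 'g" and K :: "'e \<Rightarrow> 'e pmf"
    and x :: 'x and e :: 'e
  assumes "real_Lie_group G T d A"
    and "locally_compact_space X" and "second_countable X" and "metrizable_space X"
    and "continuous_action G T X act"
    and "\<And>a. g a \<in> carrier G"
    and "irreducible_chain K"
    and "x \<in> topspace X"
    and "AE \<omega> in markov_measure K e. infinite {act (word_prod G g \<omega> n) x | n. True}"
  shows "infinite {act h x | h. h \<in> renewal_semigroup G T g K e}"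
proof
  assume fin: "finite {act h x | h. h \<in> renewal_semigroup G T g K e}" (is "finite ?O")
  have T: "topspace T = carrier G" and "group G"
    using assms(1) unfolding real_Lie_group_def by blast+
  interpret group G by fact
  interpret group_action G "topspace X" act
    using assms(5) by (simp add: continuous_action_def)
  note g = assms(6)
  have "\<forall>a. \<exists>f m. f 0 = a \<and> f m = e \<and> m \<ge> 1 \<and> admissible K f m"
    using irreducible_chain_path[OF assms(7)] by metis
  then obtain v l where v: "\<And>a. v a 0 = a" "\<And>a. v a (l a) = e" "\<And>a. l a \<ge> 1"
      "\<And>a. admissible K (v a) (l a)"
    by metis
  define h where "h a = word_prod G g (v a) (l a)" for a
  have h: "h a \<in> carrier G" for a
    by (simp add: h_def word_prod_closed g)
  have fin_orbit: "finite {act (word_prod G g \<omega> n) x | n. True}"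
    if \<omega>: "\<omega> 0 = e" "\<forall>n. admissible K \<omega> n" for \<omega>
  proof (rule finite_subset)
    show "finite (\<Union>a. act (inv\<^bsub>G\<^esub> h a) ` ?O)"
      using fin by simp
    show "{act (word_prod G g \<omega> n) x | n. True} \<subseteq> (\<Union>a. act (inv\<^bsub>G\<^esub> h a) ` ?O)"
    proof clarify
      fix n
      let ?w = "word_prod G g \<omega> n"
      have w: "?w \<in> carrier G"
        by (simp add: word_prod_closed g)
      have "h (\<omega> n) \<otimes>\<^bsub>G\<^esub> ?w \<in> renewal_semigroup G T g K e"
        unfolding h_def using \<omega> v by (intro closed_up_path_in_renewal_semigroup T g) auto
      moreover have "act ?w x = act (inv\<^bsub>G\<^esub> h (\<omega> n)) (act (h (\<omega> n) \<otimes>\<^bsub>G\<^esub> ?w) x)"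
        using composition_rule[OF assms(8), of "inv\<^bsub>G\<^esub> h (\<omega> n)" "h (\<omega> n) \<otimes>\<^bsub>G\<^esub> ?w"] h w
        by (simp add: m_assoc[symmetric])
      ultimately show "act ?w x \<in> (\<Union>a. act (inv\<^bsub>G\<^esub> h a) ` ?O)"
        by blast
    qed
  qed
  have "AE \<omega> in markov_measure K e. \<not> (\<forall>i\<le>0. \<omega> i = e)"
    using AE_markov_admissible[where K = K and e = e] assms(9)
    by eventually_elim (use fin_orbit in blast)
  from emeasure_eq_0_AE[OF this]
  have "emeasure (markov_measure K e) {\<omega>. \<forall>i\<le>0. \<omega> i = e} = 0"
    by (simp only: space_markov_measure UNIV_I simp_thms)
  then show False
    unfolding emeasure_markov_cylinder_eq_0_iff by (simp add: admissible_def)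
qed

end
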